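(* There is a constant $C$ such that every locally Gabriel graph on a convexly independent set of $n\ge2$ points in the plane has at most $2n\log_2 n + Cn$ edges.
   Context: A finite point set $P\subset\mathbb{R}^2$ is convexly independent if no point of $P$ lies in the convex hull of the other points. A geometric graph $G=(P,E)$ is a locally Gabriel graph (LGG) if for every edge $\{u,v\}\in E$, the closed disk having the segment $\overline{uv}$ as diameter contains no neighbor (in $G$) of $u$ or of $v$ other than $u,v$ themselves; equivalently, two edges $\{u,v\},\{u,w\}\in E$ sharing the endpoint $u$ can coexist only if $\angle uwv<\pi/2$ and $\angle uvw<\pi/2$. *)

theory Defs
  imports "HOL-Analysis.Analysis"
begin

definition convexly_independent :: "(real^2) set \<Rightarrow> bool" where
  "convexly_independent P \<longleftrightarrow> (\<forall>p\<in>P. p \<notin> convex hull (P - {p}))"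

definition geometric_graph :: "(real^2) set \<Rightarrow> (real^2) set set \<Rightarrow> bool" where
  "geometric_graph P E \<longleftrightarrow> (\<forall>e\<in>E. \<exists>u v. e = {u, v} \<and> u \<noteq> v \<and> u \<in> P \<and> v \<in> P)"

definition locally_gabriel :: "(real^2) set \<Rightarrow> (real^2) set set \<Rightarrow> bool" where
  "locally_gabriel P E \<longleftrightarrow> geometric_graph P E \<and>
     (\<forall>u v w. {u, v} \<in> E \<and> ({u, w} \<in> E \<or> {v, w} \<in> E) \<and> w \<noteq> u \<and> w \<noteq> v
        \<longrightarrow> w \<notin> cball (midpoint u v) (dist u v / 2))"

end

theory Submission
  imports Defs
begin

text \<open>
  In generic coordinates the points split into an upper (concave) and a lower (convex) chain.
  An edge inside one chain cannot extend at both of its ends, since this would make the chain turn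
  by more than \<open>\<pi>\<close>; so there are only linearly many such edges.

  Let \<open>ab\<close> join the upper chain to the lower one. If \<open>b\<close> has a neighbour \<open>a'\<close> and \<open>a\<close> a
  neighbour \<open>b'\<close> further to the right, then the angles at \<open>a\<close> and \<open>b\<close> are acute, so the lines
  \<open>aa'\<close> and \<open>bb'\<close> converge to the right. Rank all points by their tangent slopes: the rank of
  \<open>a\<close> drops and the rank of \<open>b\<close> grows when moving right, and \<open>a'\<close> ranks below \<open>b'\<close>. Hence, as
  long as \<open>a\<close> ranks above \<open>b\<close>, at least one of the steps \<open>b \<rightarrow> b'\<close>, \<open>a \<rightarrow> a'\<close> halves the rank
  difference. Each point is therefore charged at most \<open>log\<^sub>2 n + 1\<close> such edges. The edges with \<open>a\<close>
  ranked below \<open>b\<close> are treated alike, moving left; this is the second \<open>n log\<^sub>2 n\<close>.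
\<close>

section \<open>Counting the pairs of a relation by halving a potential\<close>

lemma halving_chain_power_le:
  fixes g :: "'b \<Rightarrow> real" and D :: "'b \<Rightarrow> nat"
  assumes "finite S" "inj_on g S" "\<And>b. b \<in> S \<Longrightarrow> 1 \<le> D b"
    and "\<And>b b'. b \<in> S \<Longrightarrow> b' \<in> S \<Longrightarrow> g b < g b' \<Longrightarrow> 2 * D b' \<le> D b"
    and "S \<noteq> {}"
  shows "\<exists>b\<in>S. 2 ^ card S \<le> 2 * D b"
  using assms
\<comment> \<open>Ranking by \<open>- g\<close> adds the element of smallest \<open>g\<close> last,
  so its \<open>D\<close> is at least twice that of the previous witness. The spare factor 2 in the
  claim covers singletons.\<close>
proof (induction S rule: finite_ranking_induct[where f = "\<lambda>b. - g b"])
  case empty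
  then show ?case by simp
next
  case (insert b S)
  consider "S = {}" | "b \<in> S" | "S \<noteq> {}" "b \<notin> S" by blast
  then show ?case
  proof cases
    case 1
    then show ?thesis using insert.prems by simp
  next
    case 2
    then have "insert b S = S" by blast
    then show ?thesis using insert.IH insert.prems by metis
  next
    case 3
    have "inj_on g S" using insert.prems(1) by simp
    then have "\<exists>c\<in>S. 2 ^ card S \<le> 2 * D c"
      using insert.prems(2,3) 3(1) by (intro insert.IH) blast+
    then obtain c where c: "c \<in> S" "2 ^ card S \<le> 2 * D c" by blast
    have "c \<noteq> b" using c(1) 3(2) by blast
    then have "g b \<noteq> g c" using c(1) inj_onD[OF insert.prems(1), of b c] by blast
    then have "g b < g c" using insert.hyps(2)[OF c(1)] by simp
    then have "2 * D c \<le> D b" using insert.prems(3) c(1) by blast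
    then have "2 ^ card (insert b S) \<le> 2 * D b"
      using c(2) insert.hyps(1) 3(2) by simp
    then show ?thesis by blast
  qed
qed

lemma halving_chain_card_le:
  fixes g :: "'b \<Rightarrow> real" and D :: "'b \<Rightarrow> nat"
  assumes "finite S" "inj_on g S" "\<And>b. b \<in> S \<Longrightarrow> 1 \<le> D b \<and> D b \<le> n"
    and "\<And>b b'. b \<in> S \<Longrightarrow> b' \<in> S \<Longrightarrow> g b < g b' \<Longrightarrow> 2 * D b' \<le> D b"
    and "1 \<le> n"
  shows "real (card S) \<le> log 2 n + 1"
proof (cases "S = {}")
  case True
  then show ?thesis using assms(5) by simp
next
  case False
  have "\<exists>b\<in>S. 2 ^ card S \<le> 2 * D b"
  proof (rule halving_chain_power_le[OF assms(1,2) _ _ False])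
    show "1 \<le> D b" if "b \<in> S" for b using assms(3)[OF that] by blast
  qed (fact assms(4))
  then obtain b where b: "b \<in> S" "2 ^ card S \<le> 2 * D b" by blast
  have "2 ^ card S \<le> 2 * n" using b assms(3)[OF b(1)] by linarith
  then have "real (2 ^ card S) \<le> real (2 * n)" by (rule of_nat_mono)
  then have "(2::real) ^ card S \<le> 2 * real n" by simp
  then have "real (card S) \<le> log 2 (2 * real n)"
    using assms(5) by (simp add: le_log_iff powr_realpow)
  also have "\<dots> = log 2 n + 1" using assms(5) by (simp add: log_mult)
  finally show ?thesis .
qed

text \<open>Each pair is charged to \<open>a\<close> if moving \<open>b\<close> further always
  halves \<open>D\<close>, and to \<open>b\<close> if moving \<open>a\<close> further does. Along
  the pairs charged to one point \<open>D\<close> keeps halving within the range from 1 to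
  \<open>n\<close>, so they form a chain of logarithmic length.\<close>

lemma halving_relation_card_le:
  fixes f :: "'a \<Rightarrow> real" and g :: "'b \<Rightarrow> real" and D :: "'a \<Rightarrow> 'b \<Rightarrow> nat"
  assumes fin: "finite A" "finite B" and inj: "inj_on f A" "inj_on g B"
    and R: "R \<subseteq> A \<times> B" and n: "1 \<le> n"
    and D: "\<And>a b. (a, b) \<in> R \<Longrightarrow> 1 \<le> D a b \<and> D a b \<le> n"
    and halving: "\<And>a b a' b'. (a, b) \<in> R \<Longrightarrow> (a, b') \<in> R \<Longrightarrow> (a', b) \<in> R \<Longrightarrow>
      g b < g b' \<Longrightarrow> f a < f a' \<Longrightarrow> 2 * D a b' \<le> D a b \<or> 2 * D a' b \<le> D a b"
  shows "real (card R) \<le> (real (card A) + real (card B)) * (log 2 n + 1)"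
proof -
  define S where "S a = {b. (a, b) \<in> R \<and> (\<forall>b'. (a, b') \<in> R \<and> g b < g b' \<longrightarrow> 2 * D a b' \<le> D a b)}" for a
  define T where "T b = {a. (a, b) \<in> R \<and> (\<forall>a'. (a', b) \<in> R \<and> f a < f a' \<longrightarrow> 2 * D a' b \<le> D a b)}" for b
  have SB: "S a \<subseteq> B" for a using R by (auto simp: S_def)
  have TA: "T b \<subseteq> A" for b using R by (auto simp: T_def)
  have finS: "finite (S a)" for a using finite_subset[OF SB fin(2)] .
  have finT: "finite (T b)" for b using finite_subset[OF TA fin(1)] .
  have cS: "real (card (S a)) \<le> log 2 n + 1" for a
  proof (rule halving_chain_card_le[where g = g and D = "D a"])
    show "1 \<le> D a b \<and> D a b \<le> n" if "b \<in> S a" for b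
      using that D unfolding S_def by blast
    show "2 * D a b' \<le> D a b" if "b \<in> S a" "b' \<in> S a" "g b < g b'" for b b'
      using that unfolding S_def by blast
  qed (fact finS inj_on_subset[OF inj(2) SB] n)+
  have cT: "real (card (T b)) \<le> log 2 n + 1" for b
  proof (rule halving_chain_card_le[where g = f and D = "\<lambda>a. D a b"])
    show "1 \<le> D a b \<and> D a b \<le> n" if "a \<in> T b" for a
      using that D unfolding T_def by blast
    show "2 * D a' b \<le> D a b" if "a \<in> T b" "a' \<in> T b" "f a < f a'" for a a'
      using that unfolding T_def by blast
  qed (fact finT inj_on_subset[OF inj(1) TA] n)+
  have "R \<subseteq> Sigma A S \<union> prod.swap ` Sigma B T"
  proof
    fix p assume "p \<in> R"
    then obtain a b where p: "p = (a, b)" "(a, b) \<in> R" "a \<in> A" "b \<in> B" using R by auto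
    \<comment> \<open>Failure of both charges would supply \<open>b'\<close> and \<open>a'\<close>
      that refute both alternatives of \<open>halving\<close>.\<close>
    have "b \<in> S a \<or> a \<in> T b" using halving p(2) unfolding S_def T_def by blast
    then show "p \<in> Sigma A S \<union> prod.swap ` Sigma B T" using p by force
  qed
  then have "card R \<le> card (Sigma A S \<union> prod.swap ` Sigma B T)"
    by (intro card_mono) (use fin finS finT in auto)
  also have "\<dots> \<le> card (Sigma A S) + card (Sigma B T)"
    by (meson add_left_mono card_Un_le card_image_le fin(2) finT finite_SigmaI order_trans)
  also have "\<dots> = (\<Sum>a\<in>A. card (S a)) + (\<Sum>b\<in>B. card (T b))"
    using fin finS finT by (simp add: card_SigmaI)
  finally have "real (card R) \<le> (\<Sum>a\<in>A. real (card (S a))) + (\<Sum>b\<in>B. real (card (T b)))"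
    by (simp flip: of_nat_sum of_nat_add)
  also have "\<dots> \<le> (\<Sum>a\<in>A. log 2 n + 1) + (\<Sum>b\<in>B. log 2 n + 1)"
    using cS cT by (intro add_mono sum_mono) auto
  finally show ?thesis by (simp add: algebra_simps)
qed

section \<open>Slopes, acute angles and the edges inside one chain\<close>

definition slope :: "('a \<Rightarrow> real) \<Rightarrow> ('a \<Rightarrow> real) \<Rightarrow> 'a \<Rightarrow> 'a \<Rightarrow> real" where
  "slope x y u v = (y v - y u) / (x v - x u)"

lemma slope_commute: "slope x y u v = slope x y v u"
  unfolding slope_def by (metis minus_diff_eq minus_divide_divide)

lemma slope_uminus: "slope x (\<lambda>p. - y p) u v = - slope x y u v"
  unfolding slope_def minus_divide_left by simp

lemma slope_mult: "x u \<noteq> x v \<Longrightarrow> y v - y u = slope x y u v * (x v - x u)"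
  unfolding slope_def by simp

text \<open>The apex \<open>p\<close> comes first; the formula is the inner product of the vectors
  from \<open>p\<close> to \<open>u\<close> and to \<open>v\<close>.\<close>

definition acute_at :: "('a \<Rightarrow> real) \<Rightarrow> ('a \<Rightarrow> real) \<Rightarrow> 'a \<Rightarrow> 'a \<Rightarrow> 'a \<Rightarrow> bool" where
  "acute_at x y p u v \<longleftrightarrow> (x u - x p) * (x v - x p) + (y u - y p) * (y v - y p) > 0"

lemma acute_at_slopes:
  assumes "x u \<noteq> x p" "x v \<noteq> x p"
  shows "acute_at x y p u v \<longleftrightarrow>
    (x u - x p) * (x v - x p) * (1 + slope x y p u * slope x y p v) > 0"
proof -
  have "y u - y p = slope x y p u * (x u - x p)" "y v - y p = slope x y p v * (x v - x p)"
    using assms by (auto intro: slope_mult)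
  then have "(x u - x p) * (x v - x p) + (y u - y p) * (y v - y p) =
      (x u - x p) * (x v - x p) * (1 + slope x y p u * slope x y p v)"
    by algebra
  then show ?thesis unfolding acute_at_def by simp
qed

definition concave_chain :: "('a \<Rightarrow> real) \<Rightarrow> ('a \<Rightarrow> real) \<Rightarrow> 'a set \<Rightarrow> bool" where
  "concave_chain x y V \<longleftrightarrow> (\<forall>u\<in>V. \<forall>v\<in>V. \<forall>w\<in>V. x u < x v \<longrightarrow> x v < x w \<longrightarrow>
     slope x y v w < slope x y u v)"

text \<open>Since \<open>u\<close> and \<open>w\<close> lie on opposite sides of \<open>v\<close>,
  an acute angle at \<open>v\<close> forces the product of the slopes below -1. They have opposite
  signs, and concavity puts the positive one on the left.\<close>

lemma concave_acute_slope_neg: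
  assumes "x u < x v" "x v < x w" "slope x y v w < slope x y u v" "acute_at x y v u w"
  shows "slope x y v w < 0" "0 < slope x y u v"
proof -
  have "(x v - x u) * (x w - x v) > 0" using assms by simp
  moreover have "(x u - x v) * (x w - x v) * (1 + slope x y v u * slope x y v w) > 0"
    using assms by (simp add: acute_at_slopes)
  then have "(x v - x u) * (x w - x v) * (1 + slope x y u v * slope x y v w) < 0"
    by (simp add: slope_commute[of x y v u] algebra_simps)
  ultimately have "slope x y u v * slope x y v w < 0"
    by (smt (verit) mult_less_0_iff)
  then show "slope x y v w < 0" "0 < slope x y u v"
    using assms(3) by (auto simp: mult_less_0_iff)
qed

lemma concave_chain_edges_card_le:
  assumes fin: "finite V" and inj: "inj_on x V" and V: "concave_chain x y V"
    and edge: "\<And>e. e \<in> E \<Longrightarrow> \<exists>u v. e = {u, v} \<and> u \<noteq> v \<and> u \<in> V \<and> v \<in> V"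
    and acute: "\<And>c p q. {c, p} \<in> E \<Longrightarrow> {c, q} \<in> E \<Longrightarrow> p \<noteq> q \<Longrightarrow> acute_at x y p c q"
  shows "card E \<le> 2 * card V"
proof -
  define R where "R = {(a, b). {a, b} \<in> E \<and> a \<in> V \<and> b \<in> V \<and> x a < x b}"
  have RV: "R \<subseteq> V \<times> V" by (auto simp: R_def)
  \<comment> \<open>With \<open>D = 1\<close> halving is impossible, so every edge is extremal at one of its ends.\<close>
  have "real (card R) \<le> (real (card V) + real (card V)) * (log 2 (1::nat) + 1)"
  proof (rule halving_relation_card_le[where D = "\<lambda>_ _. 1" and f = "\<lambda>p. - x p" and g = x])
    fix a b a' b'
    assume *: "(a, b) \<in> R" "(a, b') \<in> R" "(a', b) \<in> R" "x b < x b'" "- x a < - x a'"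
    \<comment> \<open>The order along \<open>x\<close> is \<open>a'\<close>, \<open>a\<close>,
      \<open>b\<close>, \<open>b'\<close>. The acute angle at \<open>a\<close> makes
      \<open>ab\<close> descend, the one at \<open>b\<close> makes it ascend.\<close>
    have "slope x y a b < 0"
    proof (rule concave_acute_slope_neg)
      show "acute_at x y a a' b"
        using acute[of b a a'] * unfolding R_def acute_at_def
        by (auto simp: insert_commute mult.commute)
      show "slope x y a b < slope x y a' a"
        using * V unfolding R_def concave_chain_def by auto
    qed (use * in \<open>auto simp: R_def\<close>)
    moreover have "0 < slope x y a b"
    proof (rule concave_acute_slope_neg)
      show "acute_at x y b a b'" using acute[of a b b'] * unfolding R_def by auto
      show "slope x y b b' < slope x y a b"
        using * V unfolding R_def concave_chain_def by auto
    qed (use * in \<open>auto simp: R_def\<close>)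
    ultimately show "2 * (1::nat) \<le> 1 \<or> 2 * (1::nat) \<le> 1" by simp
  qed (use fin inj RV in \<open>auto simp: inj_on_def\<close>)
  then have "card R \<le> 2 * card V" by simp
  moreover have "E \<subseteq> (\<lambda>(a, b). {a, b}) ` R"
  proof
    fix e assume e: "e \<in> E"
    then obtain u v where uv: "e = {u, v}" "u \<noteq> v" "u \<in> V" "v \<in> V" using edge by blast
    then have "x u < x v \<or> x v < x u" using inj by (metis inj_onD linorder_neqE)
    then have "(u, v) \<in> R \<or> (v, u) \<in> R" using uv e by (auto simp: R_def insert_commute)
    then show "e \<in> (\<lambda>(a, b). {a, b}) ` R" using uv(1) by (force simp: insert_commute)
  qed
  then have "card E \<le> card R"
    using finite_subset[OF RV] fin surj_card_le by blast
  ultimately show ?thesis by linarith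
qed

section \<open>Tangent slopes of a chain, and chords leaving the two ends of an edge\<close>

lemma concave_chain_tangent_slopes:
  assumes fin: "finite V" and V: "concave_chain x y V"
  obtains \<sigma> where "\<And>a a'. a \<in> V \<Longrightarrow> a' \<in> V \<Longrightarrow> x a < x a' \<Longrightarrow>
    \<sigma> a' \<le> slope x y a a' \<and> slope x y a a' \<le> \<sigma> a"
proof -
  \<comment> \<open>\<open>M\<close> serves the leftmost point, which no chord reaches from the
    left. Only its being an upper bound matters, so the default slope 0 of degenerate pairs is
    harmless.\<close>
  define M where "M = Max ((\<lambda>(u, v). slope x y u v) ` (V \<times> V))"
  \<comment> \<open>The least slope of a chord arriving from the left; by concavity every chord
    leaving to the right is flatter.\<close>
  define \<sigma> where "\<sigma> a = Min (insert M ((\<lambda>u. slope x y u a) ` {u \<in> V. x u < x a}))" for a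
  have "\<sigma> a' \<le> slope x y a a' \<and> slope x y a a' \<le> \<sigma> a"
    if a: "a \<in> V" "a' \<in> V" "x a < x a'" for a a'
  proof
    show "\<sigma> a' \<le> slope x y a a'"
      unfolding \<sigma>_def using a fin by (intro Min_le) auto
    have "slope x y a a' \<le> M"
      unfolding M_def using a fin by (intro Max_ge) force+
    moreover have "slope x y a a' \<le> slope x y u a" if "u \<in> V" "x u < x a" for u
      using V a that unfolding concave_chain_def by (meson less_imp_le)
    ultimately show "slope x y a a' \<le> \<sigma> a"
      unfolding \<sigma>_def using fin by (subst Min_ge_iff) auto
  qed
  then show ?thesis by (rule that)
qed

text \<open>Here \<open>(d1, d2)\<close> is the vector from \<open>a\<close> to \<open>b\<close>,
  and \<open>s\<close>, \<open>t\<close> are the slopes of chords leaving \<open>a\<close> and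
  \<open>b\<close> to the right. Subtracting the two acute-angle conditions gives
  \<open>d2 * (s - t) > 0\<close>. The last two hypotheses exclude \<open>d2 > 0\<close>, whichever
  end lies further left.\<close>

lemma facing_acute_slopes_less:
  fixes d1 d2 s t :: real
  assumes "d1 + s * d2 > 0" "d1 + t * d2 < 0" "d1 \<noteq> 0"
    and "d1 > 0 \<Longrightarrow> d2 < t * d1" "d1 < 0 \<Longrightarrow> d2 < s * d1"
  shows "s < t"
proof (rule ccontr)
  assume "\<not> s < t"
  then have st: "t \<le> s" by simp
  have "d2 * (s - t) > 0" using assms(1,2) by (simp add: algebra_simps)
  then have d2: "d2 > 0" using st by (simp add: zero_less_mult_iff)
  consider "d1 > 0" | "d1 < 0" using assms(3) by linarith
  then show False
  proof cases
    case 1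
    then have "t * d2 < 0" using assms(2) by linarith
    then have "t < 0" using d2 by (simp add: mult_less_0_iff)
    then have "t * d1 < 0" using 1 by (simp add: mult_less_0_iff)
    then show False using assms(4) 1 d2 by linarith
  next
    case 2
    then have "s * d2 > 0" using assms(1) by linarith
    then have "s > 0" using d2 by (simp add: zero_less_mult_iff)
    then have "s * d1 < 0" using 2 by (simp add: mult_less_0_iff)
    then show False using assms(5) 2 d2 by linarith
  qed
qed

text \<open>Tested against all of \<open>P\<close>, so that an edge to the opposite chain can be
  compared with chords of the own chain. Lower points are the upper points for \<open>- y\<close>;
  points of extreme \<open>x\<close> satisfy both vacuously.\<close>

definition upper_point :: "('a \<Rightarrow> real) \<Rightarrow> ('a \<Rightarrow> real) \<Rightarrow> 'a set \<Rightarrow> 'a \<Rightarrow> bool" where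
  "upper_point x y P v \<longleftrightarrow> (\<forall>u\<in>P. \<forall>w\<in>P. x u < x v \<longrightarrow> x v < x w \<longrightarrow>
     slope x y v w < slope x y u v)"

lemma slope_reflect: "slope (\<lambda>p. - x p) y u v = - slope x y u v"
  unfolding slope_def by (simp add: minus_divide_right)

lemma upper_point_reflect:
  assumes "upper_point x y P v"
  shows "upper_point (\<lambda>p. - x p) y P v"
  unfolding upper_point_def slope_reflect
proof (intro ballI impI)
  fix u w assume "u \<in> P" "w \<in> P" "- x u < - x v" "- x v < - x w"
  then have "slope x y v u < slope x y w v" using assms unfolding upper_point_def by simp
  then show "- slope x y v w < - slope x y u v"
    by (simp add: slope_commute[of x y u v] slope_commute[of x y v w])
qed

lemma upper_points_concave_chain:
  assumes "V \<subseteq> P" "\<And>v. v \<in> V \<Longrightarrow> upper_point x y P v"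
  shows "concave_chain x y V"
  using assms unfolding concave_chain_def upper_point_def by (meson subsetD)

text \<open>Dividing the inner products at \<open>a\<close> and \<open>b\<close> by the positive
  widths of the two chords gives the sign conditions of \<open>facing_acute_slopes_less\<close>. Its
  convexity conditions compare the slope of \<open>ab\<close> with the chord at whichever end lies
  further right.\<close>

lemma facing_slopes_less:
  assumes inj: "inj_on x P" and P: "a \<in> P" "b \<in> P" "a' \<in> P" "b' \<in> P"
    and a: "upper_point x y P a" and b: "upper_point x (\<lambda>p. - y p) P b"
    and "a \<noteq> b" and less: "x a < x a'" "x b < x b'"
    and acute: "acute_at x y a b a'" "acute_at x y b a b'"
  shows "slope x y a a' < slope x y b b'"
proof -
  let ?d1 = "x b - x a" and ?d2 = "y b - y a"
  let ?s = "slope x y a a'" and ?t = "slope x y b b'"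
  have d1: "?d1 \<noteq> 0" using inj P \<open>a \<noteq> b\<close> by (auto simp: inj_on_def)
  have s: "y a' - y a = ?s * (x a' - x a)" using less by (intro slope_mult) auto
  have t: "y b' - y b = ?t * (x b' - x b)" using less by (intro slope_mult) auto
  have d: "?d2 = slope x y a b * ?d1" using d1 by (intro slope_mult) auto
  show ?thesis
  proof (rule facing_acute_slopes_less)
    have "(x a' - x a) * (?d1 + ?s * ?d2) > 0"
      using acute(1) unfolding acute_at_def s by (simp add: algebra_simps)
    then show "?d1 + ?s * ?d2 > 0" using less by (simp add: zero_less_mult_iff)
    have "(x b' - x b) * (?d1 + ?t * ?d2) < 0"
      using acute(2) unfolding acute_at_def t by (simp add: algebra_simps)
    then show "?d1 + ?t * ?d2 < 0" using less by (simp add: mult_less_0_iff)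
    show "?d2 < ?t * ?d1" if "?d1 > 0"
    proof -
      have "slope x y a b < ?t"
        using b P that less unfolding upper_point_def by (simp add: slope_uminus)
      then show ?thesis unfolding d using that by simp
    qed
    show "?d2 < ?s * ?d1" if "?d1 < 0"
    proof -
      have "?s < slope x y a b"
        using a P that less unfolding upper_point_def by (simp add: slope_commute[of x y a b])
      then show ?thesis unfolding d using that by simp
    qed
  qed (fact d1)
qed

lemma facing_slopes_greater:
  assumes inj: "inj_on x P" and P: "a \<in> P" "b \<in> P" "a' \<in> P" "b' \<in> P"
    and a: "upper_point x y P a" and b: "upper_point x (\<lambda>p. - y p) P b"
    and "a \<noteq> b" and less: "x a' < x a" "x b' < x b"
    and acute: "acute_at x y a b a'" "acute_at x y b a b'"
  shows "slope x y b' b < slope x y a' a"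
proof -
  \<comment> \<open>Mirroring \<open>x\<close> exchanges left and right, negates slopes and keeps
    upper points upper.\<close>
  have "slope (\<lambda>p. - x p) y a a' < slope (\<lambda>p. - x p) y b b'"
  proof (rule facing_slopes_less[where P = P])
    show "inj_on (\<lambda>p. - x p) P" using inj by (auto simp: inj_on_def)
    show "acute_at (\<lambda>p. - x p) y a b a'" "acute_at (\<lambda>p. - x p) y b a b'"
      using acute unfolding acute_at_def by (simp_all add: algebra_simps)
  qed (use P less \<open>a \<noteq> b\<close> a b in \<open>auto intro: upper_point_reflect\<close>)
  then show ?thesis by (simp add: slope_reflect slope_commute)
qed

section \<open>Edges between the two chains\<close>

lemma upper_lower_edges_card_le:
  assumes fin: "finite P" and inj: "inj_on x P" and UL: "U \<union> L = P" "U \<inter> L = {}"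
    and U: "\<And>v. v \<in> U \<Longrightarrow> upper_point x y P v"
    and L: "\<And>v. v \<in> L \<Longrightarrow> upper_point x (\<lambda>p. - y p) P v"
    and n: "1 \<le> card P"
    and acute: "\<And>c p q. {c, p} \<in> E \<Longrightarrow> {c, q} \<in> E \<Longrightarrow> p \<noteq> q \<Longrightarrow> acute_at x y p c q"
  shows "real (card {(a, b). a \<in> U \<and> b \<in> L \<and> {a, b} \<in> E}) \<le>
    2 * real (card P) * (log 2 (card P) + 1)"
proof -
  have sub: "U \<subseteq> P" "L \<subseteq> P" using UL by auto
  have finUL: "finite U" "finite L" using sub fin finite_subset by auto
  have injUL: "inj_on x U" "inj_on x L" using inj_on_subset[OF inj] sub by auto
  have card: "real (card U) + real (card L) = real (card P)"
    using card_Un_disjoint[OF finUL UL(2)] UL(1) by simp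
  obtain \<sigma> where \<sigma>: "\<And>a a'. a \<in> U \<Longrightarrow> a' \<in> U \<Longrightarrow> x a < x a' \<Longrightarrow>
      \<sigma> a' \<le> slope x y a a' \<and> slope x y a a' \<le> \<sigma> a"
    using concave_chain_tangent_slopes[OF finUL(1) upper_points_concave_chain[OF sub(1) U]] by metis
  obtain \<tau> where \<tau>: "\<And>b b'. b \<in> L \<Longrightarrow> b' \<in> L \<Longrightarrow> x b < x b' \<Longrightarrow>
      \<tau> b' \<le> - slope x y b b' \<and> - slope x y b b' \<le> \<tau> b"
    using concave_chain_tangent_slopes[OF finUL(2) upper_points_concave_chain[OF sub(2) L]]
    unfolding slope_uminus by metis
  \<comment> \<open>\<open>\<tau>\<close> belongs to the chain for \<open>- y\<close>; negating it
    turns it back into a slope in the original coordinates, comparable with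
    \<open>\<sigma>\<close>.\<close>
  define lab where "lab v = (if v \<in> U then \<sigma> v else - \<tau> v)" for v
  define rk where "rk v = card {u \<in> P. lab u < lab v}" for v
  have lab_L: "lab b = - \<tau> b" if "b \<in> L" for b using that UL(2) by (auto simp: lab_def)
  have rk_less: "rk u < rk v" if "lab u < lab v" "u \<in> P" for u v
    unfolding rk_def by (rule psubset_card_mono) (use that fin in auto)
  have rk_lt: "rk v < card P" if "v \<in> P" for v
    unfolding rk_def by (rule psubset_card_mono) (use that fin in auto)
  \<comment> \<open>The labels satisfy \<open>lab a'\<close> \<le> slope of \<open>aa'\<close> <
    slope of \<open>bb'\<close> \<le> \<open>lab b'\<close>.\<close>
  have right: "rk a' < rk b'"
    if "a \<in> U" "a' \<in> U" "b \<in> L" "b' \<in> L" "{a, b} \<in> E" "{a, b'} \<in> E" "{a', b} \<in> E"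
      "x a < x a'" "x b < x b'" for a b a' b'
  proof (rule rk_less)
    have "slope x y a a' < slope x y b b'"
      by (rule facing_slopes_less[OF inj])
        (use that sub UL(2) U L acute[of a b b'] acute[of b a a'] in \<open>auto simp: insert_commute\<close>)
    then show "lab a' < lab b'"
      using \<sigma>[of a a'] \<tau>[of b b'] that lab_L[of b'] by (simp add: lab_def)
  qed (use that sub in auto)
  have left: "rk b' < rk a'"
    if "a \<in> U" "a' \<in> U" "b \<in> L" "b' \<in> L" "{a, b} \<in> E" "{a, b'} \<in> E" "{a', b} \<in> E"
      "x a' < x a" "x b' < x b" for a b a' b'
  proof (rule rk_less)
    have "slope x y b' b < slope x y a' a"
      by (rule facing_slopes_greater[OF inj])
        (use that sub UL(2) U L acute[of a b b'] acute[of b a a'] in \<open>auto simp: insert_commute\<close>)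
    then show "lab b' < lab a'"
      using \<sigma>[of a' a] \<tau>[of b' b] that lab_L[of b'] by (simp add: lab_def)
  qed (use that sub in auto)
  define R where "R = {(a, b). a \<in> U \<and> b \<in> L \<and> {a, b} \<in> E}"
  define R1 where "R1 = {(a, b) \<in> R. rk b \<le> rk a}"
  define R2 where "R2 = {(a, b) \<in> R. rk a < rk b}"
  have "real (card R1) \<le> (real (card U) + real (card L)) * (log 2 (card P) + 1)"
  \<comment> \<open>Equal ranks occur in \<open>R1\<close>, so 1 is added to keep \<open>D\<close>
    positive. As \<open>rk a' < rk b'\<close>, the potentials of \<open>(a, b')\<close> and
    \<open>(a', b)\<close> sum to at most that of \<open>(a, b)\<close>, so one of them is at most
    half of it.\<close>
  proof (rule halving_relation_card_le[where f = x and g = x and D = "\<lambda>a b. rk a - rk b + 1"])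
    fix a b a' b'
    assume *: "(a, b) \<in> R1" "(a, b') \<in> R1" "(a', b) \<in> R1" "x b < x b'" "x a < x a'"
    then have "rk a' < rk b'" using right[of a a' b b'] by (auto simp: R1_def R_def)
    then show "2 * (rk a - rk b' + 1) \<le> rk a - rk b + 1 \<or>
        2 * (rk a' - rk b + 1) \<le> rk a - rk b + 1"
      using * unfolding R1_def by auto
  next
    fix a b assume "(a, b) \<in> R1"
    then show "1 \<le> rk a - rk b + 1 \<and> rk a - rk b + 1 \<le> card P"
      using rk_lt[of a] sub by (auto simp: R1_def R_def)
  qed (use finUL injUL n in \<open>auto simp: R1_def R_def\<close>)
  moreover have "real (card R2) \<le> (real (card U) + real (card L)) * (log 2 (card P) + 1)"
  \<comment> \<open>Here further means further left. The ranks differ strictly, so the difference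
    itself is positive.\<close>
  proof (rule halving_relation_card_le[where f = "\<lambda>p. - x p" and g = "\<lambda>p. - x p"
        and D = "\<lambda>a b. rk b - rk a"])
    fix a b a' b'
    assume *: "(a, b) \<in> R2" "(a, b') \<in> R2" "(a', b) \<in> R2" "- x b < - x b'" "- x a < - x a'"
    then have "rk b' < rk a'" using left[of a a' b b'] by (auto simp: R2_def R_def)
    then show "2 * (rk b' - rk a) \<le> rk b - rk a \<or> 2 * (rk b - rk a') \<le> rk b - rk a"
      using * unfolding R2_def by auto
  next
    fix a b assume "(a, b) \<in> R2"
    then show "1 \<le> rk b - rk a \<and> rk b - rk a \<le> card P"
      using rk_lt[of b] sub by (auto simp: R2_def R_def)
  qed (use finUL injUL n in \<open>auto simp: R2_def R_def inj_on_def\<close>)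
  moreover have "card R \<le> card R1 + card R2"
  proof -
    have "R = R1 \<union> R2" by (auto simp: R1_def R2_def)
    then show ?thesis by (metis card_Un_le)
  qed
  ultimately have "real (card R) \<le> 2 * real (card P) * (log 2 (card P) + 1)"
    unfolding card by (simp add: algebra_simps)
  then show ?thesis unfolding R_def .
qed

section \<open>From convex position and diameter discs to chains and acute angles\<close>

lemma convexly_independent_upper_or_lower:
  fixes P :: "(real^2) set" and t :: real
  defines "x \<equiv> \<lambda>p::real^2. p $ 1 + t * p $ 2" and "y \<equiv> \<lambda>p::real^2. p $ 2 - t * p $ 1"
  assumes P: "convexly_independent P" and v: "v \<in> P"
  shows "upper_point x y P v \<or> upper_point x (\<lambda>p. - y p) P v"
\<comment> \<open>If both fail, one segment between other points crosses the vertical line through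
  \<open>v\<close> at or above \<open>v\<close>, and another at or below it. Then \<open>v\<close>
  lies between the two crossings, hence in the hull of the others.\<close>
proof (rule ccontr)
  assume "\<not> ?thesis"
  then obtain u w u' w' where up: "u \<in> P" "w \<in> P" "x u < x v" "x v < x w"
      "slope x y u v \<le> slope x y v w"
    and low: "u' \<in> P" "w' \<in> P" "x u' < x v" "x v < x w'" "slope x y v w' \<le> slope x y u' v"
    unfolding upper_point_def slope_uminus by (auto simp: not_less)
  have x_lin: "x ((1 - s) *\<^sub>R p + s *\<^sub>R q) = (1 - s) * x p + s * x q" for s p q
    unfolding x_def by (simp add: algebra_simps)
  have y_lin: "y ((1 - s) *\<^sub>R p + s *\<^sub>R q) = (1 - s) * y p + s * y q" for s p q
    unfolding y_def by (simp add: algebra_simps)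
  let ?H = "convex hull (P - {v})"
  have comb: "(1 - s) *\<^sub>R p + s *\<^sub>R q \<in> ?H" if "p \<in> ?H" "q \<in> ?H" "0 \<le> s" "s \<le> 1" for s p q
    using that convexD[OF convex_convex_hull, of p "P - {v}" q "1 - s" s] by auto
  \<comment> \<open>\<open>q\<close> is where the segment \<open>pr\<close> meets the vertical
    through \<open>v\<close>; its height over \<open>v\<close> has the sign of the slope
    difference.\<close>
  have crossing: "\<exists>q\<in>?H. x q = x v \<and>
      y q - y v = (slope x y v r - slope x y p v) * ((x v - x p) * (x r - x v) / (x r - x p))"
    if "p \<in> P" "r \<in> P" "x p < x v" "x v < x r" for p r
  proof -
    define s where "s = (x v - x p) / (x r - x p)"
    define q where "q = (1 - s) *\<^sub>R p + s *\<^sub>R r"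
    have s: "0 \<le> s" "s \<le> 1" using that by (auto simp: s_def divide_simps)
    have "p \<in> ?H" "r \<in> ?H" using that by (auto intro!: hull_inc)
    then have "q \<in> ?H" unfolding q_def using s by (intro comb)
    moreover have "s * (x r - x p) = x v - x p" using that by (simp add: s_def)
    then have "x q = x v" unfolding q_def x_lin by (simp add: algebra_simps)
    moreover have "y q - y v = s * (y r - y v) - (1 - s) * (y v - y p)"
      unfolding q_def y_lin by (simp add: algebra_simps)
    then have "y q - y v = slope x y v r * (s * (x r - x v))
        - slope x y p v * ((1 - s) * (x v - x p))"
      using slope_mult[of x v r y] slope_mult[of x p v y] that by simp
    moreover have "s * (x r - x v) = (x v - x p) * (x r - x v) / (x r - x p)" by (simp add: s_def)
    moreover have "1 - s = (x r - x v) / (x r - x p)" using that by (simp add: s_def field_simps)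
    then have "(1 - s) * (x v - x p) = (x v - x p) * (x r - x v) / (x r - x p)"
      by (simp add: mult.commute)
    ultimately have "y q - y v = (slope x y v r - slope x y p v)
        * ((x v - x p) * (x r - x v) / (x r - x p))"
      by (simp only: left_diff_distrib)
    then show ?thesis using \<open>q \<in> ?H\<close> \<open>x q = x v\<close> by blast
  qed
  obtain q where q: "q \<in> ?H" "x q = x v" "y q \<ge> y v"
  proof -
    have "(slope x y v w - slope x y u v) * ((x v - x u) * (x w - x v) / (x w - x u)) \<ge> 0"
      using up by auto
    then show ?thesis using crossing[OF up(1-4)] that by force
  qed
  obtain q' where q': "q' \<in> ?H" "x q' = x v" "y q' \<le> y v"
  proof -
    have "(slope x y v w' - slope x y u' v) * ((x v - x u') * (x w' - x v) / (x w' - x u')) \<le> 0"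
      using low by (intro mult_nonpos_nonneg) auto
    then show ?thesis using crossing[OF low(1-4)] that by force
  qed
  have inj: "p = r" if "x p = x r" "y p = y r" for p r
  proof -
    have "(1 + t * t) * (p $ 2 - r $ 2) = 0" "(1 + t * t) * (p $ 1 - r $ 1) = 0"
      using that unfolding x_def y_def by algebra+
    moreover have "1 + t * t \<noteq> 0" by (smt (verit) zero_le_square)
    ultimately show ?thesis by (simp add: vec_eq_iff forall_2)
  qed
  have "v \<in> ?H"
  proof (cases "y q = y q'")
    case True
    then show ?thesis using q q' inj[of q v] by force
  next
    case False
    \<comment> \<open>The weight at which the point between \<open>q\<close> and \<open>q'\<close>
      has height \<open>y v\<close>.\<close>
    define s where "s = (y q - y v) / (y q - y q')"
    have "0 \<le> s" "s \<le> 1" using q q' False by (auto simp: s_def divide_simps)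
    then have "(1 - s) *\<^sub>R q + s *\<^sub>R q' \<in> ?H" using q q' by (intro comb)
    moreover have "(1 - s) *\<^sub>R q + s *\<^sub>R q' = v"
    proof (rule inj)
      show "x ((1 - s) *\<^sub>R q + s *\<^sub>R q') = x v"
        unfolding x_lin using q q' by (simp add: algebra_simps)
      have "s * (y q - y q') = y q - y v" using False by (simp add: s_def)
      then show "y ((1 - s) *\<^sub>R q + s *\<^sub>R q') = y v"
        unfolding y_lin by (simp add: algebra_simps)
    qed
    ultimately show ?thesis by simp
  qed
  then show False using P v unfolding convexly_independent_def by blast
qed

text \<open>Two points with different second coordinates collide for exactly one \<open>t\<close>,
  and distinct points with equal ones never collide, so finitely many values are excluded.\<close>

lemma ex_shear_injective:
  fixes P :: "(real^2) set"
  assumes "finite P"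
  obtains t :: real where "inj_on (\<lambda>p. p $ 1 + t * p $ 2) P"
proof -
  obtain t where t: "t \<notin> (\<lambda>(p, q). - (p $ 1 - q $ 1) / (p $ 2 - q $ 2)) ` (P \<times> P)"
    using ex_new_if_finite[OF infinite_UNIV_char_0, of "(\<lambda>(p, q). - (p $ 1 - q $ 1) / (p $ 2 - q $ 2)) ` (P \<times> P)"]
      assms by auto
  have "inj_on (\<lambda>p. p $ 1 + t * p $ 2) P"
  proof (rule inj_onI)
    fix p q assume pq: "p \<in> P" "q \<in> P" "p $ 1 + t * p $ 2 = q $ 1 + t * q $ 2"
    show "p = q"
    proof (cases "p $ 2 = q $ 2")
      case True
      then show ?thesis using pq by (simp add: vec_eq_iff forall_2)
    next
      case False
      then have "t = - (p $ 1 - q $ 1) / (p $ 2 - q $ 2)" using pq by (simp add: field_simps)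
      then show ?thesis using t pq by force
    qed
  qed
  then show ?thesis by (rule that)
qed

text \<open>Thales: the inner product equals the squared distance of \<open>w\<close> from the
  centre minus the squared radius.\<close>

lemma outside_diameter_ball_inner_pos:
  fixes u v w :: "'a::real_inner"
  assumes "w \<notin> cball (midpoint u v) (dist u v / 2)"
  shows "(u - w) \<bullet> (v - w) > 0"
proof -
  have "dist u v / 2 < dist (midpoint u v) w" using assms by simp
  then have "(dist u v / 2)\<^sup>2 < (dist (midpoint u v) w)\<^sup>2" by (intro power_strict_mono) auto
  moreover have "(dist (midpoint u v) w)\<^sup>2 - (dist u v / 2)\<^sup>2 = (u - w) \<bullet> (v - w)"
    by (simp add: dist_norm power2_norm_eq_inner midpoint_def power_divide
        inner_simps inner_commute field_simps)
  ultimately show ?thesis by linarith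
qed

text \<open>The disc on \<open>cq\<close> misses \<open>p\<close>. The new coordinates are a
  rotation with scaling, which multiplies inner products by \<open>1 + t\<^sup>2\<close> and so
  keeps angles acute.\<close>

lemma locally_gabriel_acute:
  assumes G: "locally_gabriel P E" and e: "{c, p} \<in> E" "{c, q} \<in> E" "p \<noteq> q"
  shows "acute_at (\<lambda>p. p $ 1 + t * p $ 2) (\<lambda>p. p $ 2 - t * p $ 1) p c q"
proof -
  have "p \<noteq> c"
    using G e(1) unfolding locally_gabriel_def geometric_graph_def
    by (metis doubleton_eq_iff)
  then have "(c - p) \<bullet> (q - p) > 0"
    using G e unfolding locally_gabriel_def
    by (intro outside_diameter_ball_inner_pos) blast
  then have "(1 + t\<^sup>2) * ((c - p) \<bullet> (q - p)) > 0"
    by (intro mult_pos_pos) (auto intro: add_pos_nonneg)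
  then show ?thesis
    unfolding acute_at_def
    by (simp add: inner_vec_def UNIV_2 algebra_simps power2_eq_square)
qed

section \<open>Adding up the edges inside and between the chains\<close>

theorem theorem4p4:
  shows "\<exists>C::real. \<forall>(P::(real^2) set) E.
           finite P \<and> card P \<ge> 2 \<and> convexly_independent P \<and> locally_gabriel P E
           \<longrightarrow> real (card E) \<le> 2 * real (card P) * log 2 (real (card P)) + C * real (card P)"
proof (intro exI allI impI)
  fix P :: "(real^2) set" and E
  assume "finite P \<and> card P \<ge> 2 \<and> convexly_independent P \<and> locally_gabriel P E"
  then have P: "finite P" "card P \<ge> 2" "convexly_independent P" and G: "locally_gabriel P E"
    by auto
  obtain t where inj: "inj_on (\<lambda>p. p $ 1 + t * p $ 2) P" using ex_shear_injective[OF P(1)] .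
  define x where "x = (\<lambda>p::real^2. p $ 1 + t * p $ 2)"
  define y where "y = (\<lambda>p::real^2. p $ 2 - t * p $ 1)"
  have injx: "inj_on x P" using inj by (simp add: x_def)
  have acute: "acute_at x y p c q" if "{c, p} \<in> E" "{c, q} \<in> E" "p \<noteq> q" for c p q
    unfolding x_def y_def using locally_gabriel_acute[OF G that] .
  have edge: "\<exists>u v. e = {u, v} \<and> u \<noteq> v \<and> u \<in> P \<and> v \<in> P" if "e \<in> E" for e
    using G that unfolding locally_gabriel_def geometric_graph_def by blast
  \<comment> \<open>Points that are both upper and lower go to \<open>U\<close>, which makes the two
    chains disjoint.\<close>
  define U where "U = {v \<in> P. upper_point x y P v}"
  define L where "L = P - U"
  have U: "upper_point x y P v" if "v \<in> U" for v using that by (simp add: U_def)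
  have L: "upper_point x (\<lambda>p. - y p) P v" if "v \<in> L" for v
    using that convexly_independent_upper_or_lower[OF P(3), of v t]
    by (auto simp: U_def L_def x_def y_def)
  have UL: "U \<union> L = P" "U \<inter> L = {}" by (auto simp: U_def L_def)
  have finUL: "finite U" "finite L" using UL(1) P(1) by auto
  have card: "card U + card L = card P" using card_Un_disjoint[OF finUL UL(2)] UL(1) by simp
  define EU where "EU = {e \<in> E. e \<subseteq> U}"
  define EL where "EL = {e \<in> E. e \<subseteq> L}"
  define R where "R = {(a, b). a \<in> U \<and> b \<in> L \<and> {a, b} \<in> E}"
  have finR: "finite R"
    by (rule finite_subset[of _ "U \<times> L"]) (use finUL in \<open>auto simp: R_def\<close>)
  have finE: "finite E"
    by (rule finite_subset[of _ "Pow P"]) (use edge P(1) in force)+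
  have "card EU \<le> 2 * card U"
  proof (rule concave_chain_edges_card_le[where x = x and y = y])
    show "inj_on x U" using injx UL(1) inj_on_subset by blast
    show "concave_chain x y U" using upper_points_concave_chain[OF _ U] UL(1) by blast
    show "\<exists>u v. e = {u, v} \<and> u \<noteq> v \<and> u \<in> U \<and> v \<in> U" if "e \<in> EU" for e
      using edge[of e] that unfolding EU_def by blast
  qed (use finUL acute in \<open>auto simp: EU_def\<close>)
  moreover have "card EL \<le> 2 * card L"
  proof (rule concave_chain_edges_card_le[where x = x and y = "\<lambda>p. - y p"])
    show "inj_on x L" using injx UL(1) inj_on_subset by blast
    show "concave_chain x (\<lambda>p. - y p) L" using upper_points_concave_chain[OF _ L] UL(1) by blast
    show "\<exists>u v. e = {u, v} \<and> u \<noteq> v \<and> u \<in> L \<and> v \<in> L" if "e \<in> EL" for e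
      using edge[of e] that unfolding EL_def by blast
    show "acute_at x (\<lambda>p. - y p) p c q" if "{c, p} \<in> EL" "{c, q} \<in> EL" "p \<noteq> q" for c p q
      using acute[of c p q] that unfolding EL_def acute_at_def by (simp add: algebra_simps)
  qed (use finUL in auto)
  moreover have "real (card R) \<le> 2 * real (card P) * (log 2 (card P) + 1)"
    unfolding R_def using P(2)
    by (intro upper_lower_edges_card_le[OF P(1) injx UL U L _ acute]) auto
  moreover have "card E \<le> card EU + card EL + card R"
  proof -
    have "E \<subseteq> EU \<union> EL \<union> (\<lambda>(a, b). {a, b}) ` R"
    proof
      fix e assume e: "e \<in> E"
      then obtain u v where uv: "e = {u, v}" "u \<in> P" "v \<in> P" using edge by blast
      then consider "u \<in> U" "v \<in> U" | "u \<in> L" "v \<in> L" | "u \<in> U" "v \<in> L" | "v \<in> U" "u \<in> L"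
        using UL(1) by blast
      then show "e \<in> EU \<union> EL \<union> (\<lambda>(a, b). {a, b}) ` R"
        using e uv(1) by cases (force simp: EU_def EL_def R_def insert_commute)+
    qed
    then have "card E \<le> card (EU \<union> EL \<union> (\<lambda>(a, b). {a, b}) ` R)"
      by (intro card_mono) (use finE finR in \<open>auto simp: EU_def EL_def\<close>)
    also have "\<dots> \<le> card EU + card EL + card ((\<lambda>(a, b). {a, b}) ` R)"
      by (meson add_le_mono1 card_Un_le order_trans)
    also have "\<dots> \<le> card EU + card EL + card R"
      using card_image_le[OF finR] by simp
    finally show ?thesis .
  qed
  \<comment> \<open>Of the constant 4, the edges inside the chains contribute 2, and the summand 1
    beside the logarithm contributes the other 2.\<close>
  ultimately show "real (card E) \<le> 2 * real (card P) * log 2 (real (card P)) + 4 * real (card P)"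
    using card by (simp add: algebra_simps)
qed

end
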